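(* Let $\alpha\in[0,1]$ and $\beta\in(0,1]$. For $n\ge m\ge2$, the complete bipartite graph $K_{m,n}$ satisfies \[ \mathrm{Z}_{\alpha,\beta}(K_{m,n})=\begin{cases} m+n-2 & \text{if } \beta\le(m-1)\alpha,\\ m+n-2 & \text{if } (m-1)\alpha<\beta\le(n-1)\alpha \text{ and } \beta\le(m-1)\alpha+(n-1)\alpha^2,\\ m+n-1 & \text{if } (n-1)\alpha<\beta\le n\alpha \text{ or } (m-1)\alpha+(n-1)\alpha^2<\beta\le n\alpha,\\ m+n & \text{if } n\alpha<\beta. \end{cases} \]
   Context: All graphs are finite and simple. Let $\alpha,\beta$ be the transmission proportion and the transmission threshold, let $G$ be a graph and $B\subseteq V(G)$ a set of initially filled vertices. The transmission forcing process started from $B$ is defined as follows. Put $B_0=B$, $w_0(v)=1$ for $v\in B$ and $w_0(v)=0$ for $v\in V(G)\setminus B$. For $t\ge 1$, given the set $B_{t-1}$ of vertices filled at time $t-1$ and the weights $w_{t-1}$: for each unfilled vertex $u\in V(G)\setminus B_{t-1}$ let $\mathcal V_{t,u}$ be the set of all $v\in B_{t-1}$ such that $u$ is the only neighbor of $v$ in $V(G)\setminus B_{t-1}$ and $v\notin \mathcal V_{s,u'}$ for every $s<t$ and every $u'$ (each vertex transmits weight at most once); when $v\in\mathcal V_{t,u}$ we say $v$ forces $u$, written $v\to u$. Set $w_t(u)=w_{t-1}(u)+\sum_{v\in\mathcal V_{t,u}}\alpha\, w_{t-1}(v)$ for $u\in V(G)\setminus B_{t-1}$ and $w_t(u)=w_{t-1}(u)$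 for $u\in B_{t-1}$. Then $B_t=B_{t-1}\cup\{u\in V(G)\setminus B_{t-1} : w_t(u)\ge\beta\}$. The set $B$ is an $(\alpha,\beta)$-transmission zero forcing set of $G$ if $B_t=V(G)$ for some $t\ge 0$, and the $(\alpha,\beta)$-transmission zero forcing number $\mathrm{Z}_{\alpha,\beta}(G)$ is the minimum cardinality of such a set. *)

theory Defs
  imports Complex_Main "Graph_Theory.Kuratowski"
begin

text \<open>
  Finite simple graphs are the symmetric digraphs of the locale \<^locale>\<open>graph\<close>;
  \<open>u \<rightarrow>\<^bsub>G\<^esub> v\<close> is adjacency. \<open>a\<close> is the transmission proportion (alpha),
  \<open>b\<close> the transmission threshold (beta).

  The state of the process at time \<open>t\<close> consists of the filled set \<open>B_t\<close>, the weights \<open>w_t\<close>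
  and the set \<open>spent\<close> of the vertices that have transmitted at some time \<open>s \<le> t\<close>; the last
  component carries the history needed for ``each vertex transmits at most once''
  (see \<open>spent_transmission_process\<close> below).
\<close>

record 'a transmission_state =
  filled :: "'a set"
  weight :: "'a \<Rightarrow> real"
  spent :: "'a set"

text \<open>
  If \<open>S\<close> is the state at time \<open>t - 1\<close> and \<open>u\<close> is an unfilled vertex, this is the set
  \<open>V_{t,u}\<close> of the vertices that force \<open>u\<close> at time \<open>t\<close>.
\<close>

definition transmitters :: "('a, 'b) pre_digraph \<Rightarrow> 'a transmission_state \<Rightarrow> 'a \<Rightarrow> 'a set" where
  "transmitters G S u =
     {v \<in> filled S. {x \<in> verts G - filled S. v \<rightarrow>\<^bsub>G\<^esub> x} = {u} \<and> v \<notin> spent S}"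

definition transmission_weight ::
    "('a, 'b) pre_digraph \<Rightarrow> real \<Rightarrow> 'a transmission_state \<Rightarrow> 'a \<Rightarrow> real" where
  "transmission_weight G a S u =
     (if u \<in> verts G - filled S
      then weight S u + (\<Sum>v\<in>transmitters G S u. a * weight S v)
      else weight S u)"

definition transmission_step ::
    "('a, 'b) pre_digraph \<Rightarrow> real \<Rightarrow> real \<Rightarrow> 'a transmission_state \<Rightarrow> 'a transmission_state" where
  "transmission_step G a b S =
     \<lparr> filled = filled S \<union> {u \<in> verts G - filled S. transmission_weight G a S u \<ge> b},
       weight = transmission_weight G a S,
       spent = spent S \<union> (\<Union>u\<in>verts G - filled S. transmitters G S u) \<rparr>"

primrec transmission_process ::
    "('a, 'b) pre_digraph \<Rightarrow> real \<Rightarrow> real \<Rightarrow> 'a set \<Rightarrow> nat \<Rightarrow> 'a transmission_state" where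
  "transmission_process G a b B 0 =
     \<lparr> filled = B, weight = (\<lambda>v. if v \<in> B then 1 else 0), spent = {} \<rparr>"
| "transmission_process G a b B (Suc t) =
     transmission_step G a b (transmission_process G a b B t)"

definition transmission_zero_forcing_set ::
    "('a, 'b) pre_digraph \<Rightarrow> real \<Rightarrow> real \<Rightarrow> 'a set \<Rightarrow> bool" where
  "transmission_zero_forcing_set G a b B \<longleftrightarrow>
     B \<subseteq> verts G \<and> (\<exists>t. filled (transmission_process G a b B t) = verts G)"

definition transmission_zero_forcing_number ::
    "('a, 'b) pre_digraph \<Rightarrow> real \<Rightarrow> real \<Rightarrow> nat" where
  "transmission_zero_forcing_number G a b =
     (LEAST k. \<exists>B. transmission_zero_forcing_set G a b B \<and> card B = k)"

text \<open>The minimum is over a nonempty set:\<close>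

lemma transmission_zero_forcing_set_verts:
  "transmission_zero_forcing_set G a b (verts G)"
  unfolding transmission_zero_forcing_set_def by (auto intro: exI[of _ 0])

lemma spent_transmission_process:
  "spent (transmission_process G a b B t) =
     (\<Union>s<t. \<Union>u\<in>verts G - filled (transmission_process G a b B s).
        transmitters G (transmission_process G a b B s) u)"
  by (induction t) (simp_all add: transmission_step_def lessThan_Suc Un_commute)

end

theory Submission
  imports Defs
begin

text \<open>
  A vertex transmits only while the opposite part has exactly one unfilled vertex, so a part
  with two unfilled vertices never changes, and a forcing set misses at most one vertex of
  each part. If only one vertex is missing, it receives \<open>\<alpha>\<close> from every vertex of the other
  part. If \<open>u\<close> (in the part of size \<open>m\<close>) and \<open>v\<close> (in the part of size \<open>n\<close>) are missing, they
  receive \<open>(n - 1) \<alpha>\<close> and \<open>(m - 1) \<alpha>\<close> in the first step, after which all initially filled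
  vertices are spent; the only possible further event is that \<open>u\<close>, once filled, transmits
  \<open>(n - 1) \<alpha>\<^sup>2\<close> to \<open>v\<close>.
\<close>

section \<open>Monotonicity and stalling of the process on arbitrary graphs\<close>

lemma transmission_zero_forcing_number_eqI:
  assumes "transmission_zero_forcing_set G a b B" and "card B = k"
    and "\<And>C. transmission_zero_forcing_set G a b C \<Longrightarrow> k \<le> card C"
  shows "transmission_zero_forcing_number G a b = k"
  unfolding transmission_zero_forcing_number_def
  using assms by (intro Least_equality) auto

lemma filled_transmission_step:
  "filled (transmission_step G a b S) =
     filled S \<union> {u \<in> verts G - filled S. b \<le> transmission_weight G a S u}"
  and weight_transmission_step:
  "weight (transmission_step G a b S) = transmission_weight G a S"
  and spent_transmission_step:
  "spent (transmission_step G a b S) =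
     spent S \<union> (\<Union>u\<in>verts G - filled S. transmitters G S u)"
  by (simp_all add: transmission_step_def)

text \<open>Without transmitters no weight moves, so no unfilled vertex crosses the threshold and
  nobody new is spent. The whole state, not only its filled set, is then a fixed point.\<close>

lemma transmission_step_stalled:
  assumes "\<And>u. u \<in> verts G - filled S \<Longrightarrow> transmitters G S u = {} \<and> weight S u < b"
  shows "transmission_step G a b S = S"
proof -
  have "transmission_weight G a S = weight S"
    using assms by (auto simp: transmission_weight_def)
  then show ?thesis
    using assms by (intro transmission_state.equality)
      (fastforce simp: filled_transmission_step weight_transmission_step spent_transmission_step)+
qed

lemma filled_transmission_process_mono:
  "s \<le> t \<Longrightarrow> filled (transmission_process G a b B s) \<subseteq> filled (transmission_process G a b B t)"
  by (induction t) (auto simp: le_Suc_eq filled_transmission_step)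

lemma filled_transmission_process_subset:
  "B \<subseteq> verts G \<Longrightarrow> filled (transmission_process G a b B t) \<subseteq> verts G"
  by (induction t) (auto simp: filled_transmission_step)

lemma transmission_zero_forcing_setI:
  "B \<subseteq> verts G \<Longrightarrow> filled (transmission_process G a b B t) = verts G \<Longrightarrow>
    transmission_zero_forcing_set G a b B"
  by (auto simp: transmission_zero_forcing_set_def)

text \<open>A fixed state repeats forever. Filled sets only grow, so a complete filling at time
  \<open>s\<close> would persist at time \<open>t + s\<close>, where the state is still the
  incomplete one of time \<open>t\<close>.\<close>

lemma not_forcing_if_stalled:
  assumes "transmission_step G a b (transmission_process G a b B t) = transmission_process G a b B t"
    and "filled (transmission_process G a b B t) \<noteq> verts G"
  shows "\<not> transmission_zero_forcing_set G a b B"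
proof
  assume "transmission_zero_forcing_set G a b B"
  then obtain s where B: "B \<subseteq> verts G" and s: "filled (transmission_process G a b B s) = verts G"
    by (auto simp: transmission_zero_forcing_set_def)
  have const: "transmission_process G a b B (t + k) = transmission_process G a b B t" for k
    using assms(1) by (induction k) auto
  have "verts G \<subseteq> filled (transmission_process G a b B (t + s))"
    using filled_transmission_process_mono[of s "t + s" G a b B] s by simp
  then show False
    using assms(2) filled_transmission_process_subset[OF B, of a b t] by (simp add: const)
qed

section \<open>Transmission in a complete bipartite graph\<close>

locale complete_bipartition =
  fixes G :: "('a, 'b) pre_digraph" and U V :: "'a set"
  assumes verts_eq: "verts G = U \<union> V"
    and disjoint: "U \<inter> V = {}"
    and finite_left: "finite U"
    and finite_right: "finite V"
    and arcs_ends_eq: "arcs_ends G = U \<times> V \<union> V \<times> U"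
begin

text \<open>The locale treats both parts alike and fixes no cardinalities, so each result about
  \<open>U\<close> has a mirror image about \<open>V\<close>.\<close>

lemma swap: "complete_bipartition G V U"
  using verts_eq disjoint finite_left finite_right arcs_ends_eq by unfold_locales auto

text \<open>All vertices of \<open>V\<close> see the same unfilled neighbours, namely
  \<open>U - filled S\<close>. Hence either every filled unspent vertex of \<open>V\<close> forces
  \<open>u\<close>, or none does; vertices of \<open>U\<close> are not adjacent to
  \<open>u\<close>.\<close>

lemma transmitters_left:
  assumes "u \<in> U - filled S" and "filled S \<subseteq> verts G"
  shows "transmitters G S u = (if U - filled S = {u} then V \<inter> filled S - spent S else {})"
proof -
  have "{x \<in> verts G - filled S. w \<rightarrow>\<^bsub>G\<^esub> x} = U - filled S" if "w \<in> V" for w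
    using that verts_eq disjoint arcs_ends_eq by auto
  moreover have "{x \<in> verts G - filled S. w \<rightarrow>\<^bsub>G\<^esub> x} \<noteq> {u}" if "w \<in> U" for w
    using that assms(1) disjoint arcs_ends_eq by auto
  ultimately have "transmitters G S u = {v \<in> V \<inter> filled S - spent S. U - filled S = {u}}"
    using assms(2) verts_eq unfolding transmitters_def by blast
  then show ?thesis
    by auto
qed

lemmas transmitters_right = complete_bipartition.transmitters_left[OF swap]

text \<open>As long as \<open>x\<close> and \<open>y\<close> are both unfilled, nothing is sent into
  \<open>U\<close>. The weights belong to the invariant because filling tests the accumulated
  weight, and 0 stays below the positive threshold.\<close>

lemma left_constant:
  assumes "B \<subseteq> verts G" and "x \<in> U - B" "y \<in> U - B" "x \<noteq> y" and "0 < b"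
  shows "U - filled (transmission_process G a b B t) = U - B \<and>
    (\<forall>u\<in>U - B. weight (transmission_process G a b B t) u = 0)"
proof (induction t)
  case 0
  then show ?case by auto
next
  case (Suc t)
  let ?S = "transmission_process G a b B t"
  have "U - filled ?S \<noteq> {u}" for u
    using Suc.IH assms(2-4) by (metis singletonD)
  then have "transmitters G ?S u = {}" if "u \<in> U - B" for u
    using transmitters_left[of u ?S] filled_transmission_process_subset[OF assms(1), of a b t]
      that Suc.IH by simp
  then have w: "transmission_weight G a ?S u = 0" if "u \<in> U - B" for u
    using that Suc.IH by (simp add: transmission_weight_def)
  have "U - filled (transmission_step G a b ?S) = U - B"
    using w Suc.IH assms(5) by (auto simp: filled_transmission_step)
  then show ?case
    using w by (simp add: weight_transmission_step)
qed

section \<open>Possible shapes of a forcing set\<close>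

lemma forcing_set_left_cases:
  assumes "transmission_zero_forcing_set G a b B" and "0 < b"
  obtains "U \<subseteq> B" | u where "u \<in> U" "U - B = {u}"
proof -
  obtain t where B: "B \<subseteq> verts G" and t: "filled (transmission_process G a b B t) = verts G"
    using assms(1) by (auto simp: transmission_zero_forcing_set_def)
  have "x = y" if "x \<in> U - B" "y \<in> U - B" for x y
    using left_constant[OF B that _ assms(2), of a t] that t verts_eq by auto
  then show thesis
    using that by blast
qed

lemmas forcing_set_right_cases = complete_bipartition.forcing_set_left_cases[OF swap]

lemma forcing_set_cases:
  assumes "transmission_zero_forcing_set G a b B" and "0 < b"
  obtains "B = verts G"
  | u where "u \<in> U" "B = verts G - {u}"
  | v where "v \<in> V" "B = verts G - {v}"
  | u v where "u \<in> U" "v \<in> V" "B = verts G - {u, v}"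
proof -
  have B: "B \<subseteq> U \<union> V"
    using assms(1) verts_eq by (auto simp: transmission_zero_forcing_set_def)
  \<comment> \<open>\<open>B\<close> is determined by what it misses in each part, and either piece
    is empty or a singleton.\<close>
  have eq: "B = verts G - ((U - B) \<union> (V - B))"
    using B verts_eq by auto
  show thesis
  proof (rule forcing_set_left_cases[OF assms])
    assume "U \<subseteq> B"
    then show thesis
      using forcing_set_right_cases[OF assms] eq that(1,3)
      by (metis Diff_eq_empty_iff Diff_empty Un_empty_left)
  next
    fix u assume "u \<in> U" "U - B = {u}"
    then show thesis
      using forcing_set_right_cases[OF assms] eq that(2,4)
      by (metis Diff_eq_empty_iff Un_empty_right insert_is_Un)
  qed
qed

section \<open>Forcing with one or two initially unfilled vertices\<close>

lemma forcing_missing_left_iff: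
  assumes "u \<in> U"
  shows "transmission_zero_forcing_set G a b (verts G - {u}) \<longleftrightarrow> b \<le> real (card V) * a"
proof -
  define P where "P = transmission_process G a b (verts G - {u})"
  have u: "u \<in> verts G" "u \<notin> V"
    using assms verts_eq disjoint by auto
  have P0: "filled (P 0) = verts G - {u}" "spent (P 0) = {}"
    "weight (P 0) = (\<lambda>v. if v \<in> verts G - {u} then 1 else 0)"
    by (simp_all add: P_def)
  have P1: "P 1 = transmission_step G a b (P 0)"
    by (simp add: P_def)
  note [simp del] = One_nat_def
  have unfilled: "verts G - filled (P 0) = {u}"
    using u by (auto simp: P0)
  have "transmitters G (P 0) u = V"
    using transmitters_left[of u "P 0"] assms u verts_eq by (auto simp: P0)
  moreover have "(\<Sum>v\<in>V. a * weight (P 0) v) = (\<Sum>v\<in>V. a)"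
    using u verts_eq by (intro sum.cong) (auto simp: P0)
  ultimately have tr: "transmitters G (P 0) u = V"
    and w: "transmission_weight G a (P 0) u = real (card V) * a"
    using unfilled u by (auto simp: transmission_weight_def P0)
  have filled1: "filled (P 1) = (if b \<le> real (card V) * a then verts G else verts G - {u})"
    using w u unfolding P1 filled_transmission_step unfilled by (auto simp: P0)
  show ?thesis
  proof (cases "b \<le> real (card V) * a")
    case True
    then show ?thesis
      using transmission_zero_forcing_setI[of "verts G - {u}" G a b 1] filled1
      by (simp add: P_def)
  next
    case False
    \<comment> \<open>All neighbours of \<open>u\<close> have used their only transmission, so its
      weight stays below the threshold.\<close>
    have "spent (P 1) = V" "weight (P 1) u = real (card V) * a"
      using tr w by (simp_all add: P1 spent_transmission_step weight_transmission_step unfilled P0(2))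
    then have "transmission_step G a b (P 1) = P 1"
      using False filled1 u assms transmitters_left[of u "P 1"]
      by (intro transmission_step_stalled) auto
    then show ?thesis
      using not_forcing_if_stalled[of G a b "verts G - {u}" 1] False filled1 u
      by (auto simp: P_def)
  qed
qed

lemmas forcing_missing_right_iff = complete_bipartition.forcing_missing_left_iff[OF swap]

lemma forcing_missing_both_iff:
  assumes "u \<in> U" and "v \<in> V" and "0 \<le> a" and "card U \<le> card V"
  shows "transmission_zero_forcing_set G a b (verts G - {u, v}) \<longleftrightarrow>
    b \<le> (real (card U) - 1) * a \<or>
    b \<le> (real (card V) - 1) * a \<and> b \<le> (real (card U) - 1) * a + (real (card V) - 1) * a\<^sup>2"
proof -
  define B where "B = verts G - {u, v}"
  define P where "P = transmission_process G a b B"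
  define p where "p = (real (card U) - 1) * a"
  define q where "q = (real (card V) - 1) * a"
  \<comment> \<open>\<open>p\<close> and \<open>q\<close> are what \<open>v\<close> and
    \<open>u\<close> receive in the first step. By this inequality \<open>v\<close> cannot be filled
    in that step without \<open>u\<close>, so a second transmission can only go from
    \<open>u\<close> to \<open>v\<close>.\<close>
  have "p \<le> q"
    using assms(3,4) by (auto simp: p_def q_def intro: mult_right_mono)
  have uv: "u \<in> verts G" "v \<in> verts G" "u \<notin> V" "v \<notin> U" "u \<noteq> v"
    using assms(1,2) verts_eq disjoint by auto
  have P0: "filled (P 0) = B" "spent (P 0) = {}" "weight (P 0) = (\<lambda>x. if x \<in> B then 1 else 0)"
    by (simp_all add: P_def)
  have P1: "P 1 = transmission_step G a b (P 0)"
    by (simp add: P_def)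
  have P2: "P 2 = transmission_step G a b (P 1)"
    by (simp add: P_def numeral_2_eq_2)
  note [simp del] = One_nat_def
  have sub: "filled (P t) \<subseteq> verts G" for t
    unfolding P_def by (rule filled_transmission_process_subset) (auto simp: B_def)
  have unfilled: "verts G - filled (P 0) = {u, v}"
    using uv by (auto simp: P0 B_def)
  have "transmitters G (P 0) u = V - {v}"
    using transmitters_left[of u "P 0"] assms(1) sub[of 0] uv verts_eq by (auto simp: P0 B_def)
  moreover have "(\<Sum>x\<in>V - {v}. a * weight (P 0) x) = (\<Sum>x\<in>V - {v}. a)"
    using uv verts_eq by (intro sum.cong) (auto simp: P0 B_def)
  moreover have "real (card (V - {v})) = real (card V) - 1"
    using card_Suc_Diff1[OF finite_right assms(2)] by linarith
  ultimately have tr_u: "transmitters G (P 0) u = V - {v}"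
    and w_u: "transmission_weight G a (P 0) u = q"
    using unfilled by (auto simp: transmission_weight_def P0 q_def B_def)
  have "transmitters G (P 0) v = U - {u}"
    using transmitters_right[of v "P 0"] assms(2) sub[of 0] uv verts_eq by (auto simp: P0 B_def)
  moreover have "(\<Sum>x\<in>U - {u}. a * weight (P 0) x) = (\<Sum>x\<in>U - {u}. a)"
    using uv verts_eq by (intro sum.cong) (auto simp: P0 B_def)
  moreover have "real (card (U - {u})) = real (card U) - 1"
    using card_Suc_Diff1[OF finite_left assms(1)] by linarith
  ultimately have tr_v: "transmitters G (P 0) v = U - {u}"
    and w_v: "transmission_weight G a (P 0) v = p"
    using unfilled by (auto simp: transmission_weight_def P0 p_def B_def)
  have filled1: "filled (P 1) = B \<union> (if b \<le> q then {u} else {}) \<union> (if b \<le> p then {v} else {})"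
    using w_u w_v unfolding P1 filled_transmission_step unfilled by (auto simp: P0)
  \<comment> \<open>\<open>V - {v}\<close> has sent to \<open>u\<close> and \<open>U - {u}\<close>
    to \<open>v\<close>, which exhausts \<open>B\<close>. From now on only \<open>u\<close> or
    \<open>v\<close> could transmit.\<close>
  have spent1: "spent (P 1) = B"
    using tr_u tr_v uv unfolding P1 spent_transmission_step unfilled P0(2)
    by (auto simp: B_def verts_eq)
  have weight1: "weight (P 1) u = q" "weight (P 1) v = p"
    using w_u w_v by (simp_all add: P1 weight_transmission_step)
  have "transmission_zero_forcing_set G a b B \<longleftrightarrow> b \<le> p \<or> b \<le> q \<and> b \<le> p + a * q"
  proof (cases "b \<le> p")
    case True
    then have "filled (P 1) = verts G"
      using \<open>p \<le> q\<close> filled1 uv by (auto simp: B_def)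
    then show ?thesis
      using True transmission_zero_forcing_setI[of B G a b 1] by (auto simp: P_def B_def)
  next
    case p: False
    show ?thesis
    proof (cases "b \<le> q")
      case q: True
      have filled1': "filled (P 1) = verts G - {v}"
        using p q filled1 uv by (auto simp: B_def)
      then have unfilled1: "verts G - filled (P 1) = {v}"
        using uv by auto
      have tr1: "transmitters G (P 1) v = {u}"
        using transmitters_right[of v "P 1"] assms(1,2) uv verts_eq
        by (auto simp: filled1' spent1 B_def)
      \<comment> \<open>The vertex \<open>u\<close> passes on a proportion of its accumulated weight
        \<open>q\<close>, not of weight 1; this is the source of the term quadratic in
        \<open>a\<close>. The earlier \<open>p\<close> stays at \<open>v\<close>.\<close>
      then have w1: "transmission_weight G a (P 1) v = p + a * q"
        using unfilled1 weight1 by (simp add: transmission_weight_def)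
      have filled2: "filled (P 2) = (if b \<le> p + a * q then verts G else verts G - {v})"
        using w1 uv unfolding P2 filled_transmission_step unfilled1 by (auto simp: filled1')
      show ?thesis
      proof (cases "b \<le> p + a * q")
        case True
        then show ?thesis
          using q filled2 transmission_zero_forcing_setI[of B G a b 2] by (auto simp: P_def B_def)
      next
        case False
        \<comment> \<open>Now \<open>u\<close> is spent as well, so nothing can reach
          \<open>v\<close> any more.\<close>
        have "spent (P 2) = verts G - {v}" "weight (P 2) v = p + a * q"
          using tr1 w1 uv
          by (auto simp: P2 spent_transmission_step weight_transmission_step unfilled1 spent1 B_def)
        then have "transmission_step G a b (P 2) = P 2"
          using False filled2 uv assms(2) transmitters_right[of v "P 2"]
          by (intro transmission_step_stalled) auto
        then show ?thesis
          using not_forcing_if_stalled[of G a b B 2] p False filled2 uv by (auto simp: P_def)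
      qed
    next
      case q: False
      have filled1': "filled (P 1) = B"
        using p q filled1 by simp
      have "u \<in> U - B" "v \<in> V - B"
        using assms(1,2) by (auto simp: B_def)
      \<comment> \<open>Both vertices missed the threshold, and every filled vertex is already
        spent.\<close>
      then have "transmitters G (P 1) u = {}" "transmitters G (P 1) v = {}"
        using transmitters_left[of u "P 1"] transmitters_right[of v "P 1"] sub[of 1]
        by (auto simp: filled1' spent1)
      then have "transmission_step G a b (P 1) = P 1"
        using p q weight1 by (intro transmission_step_stalled) (auto simp: filled1' B_def)
      then show ?thesis
        using not_forcing_if_stalled[of G a b B 1] p q filled1' uv by (auto simp: P_def B_def)
    qed
  qed
  then show ?thesis
    by (simp add: B_def p_def q_def power2_eq_square mult.left_commute)
qed

end

section \<open>The value of the number in each range of \<beta>\<close>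

theorem proposition4p1p3:
  fixes \<alpha> \<beta> :: real and m n :: nat and G :: "('a, 'b) pre_digraph"
  assumes "0 \<le> \<alpha>" and "\<alpha> \<le> 1"
    and "0 < \<beta>" and "\<beta> \<le> 1"
    and "2 \<le> m" and "m \<le> n"
    and "complete_bipartite_digraph m n G"
  shows "(\<beta> \<le> (real m - 1) * \<alpha>
            \<longrightarrow> transmission_zero_forcing_number G \<alpha> \<beta> = m + n - 2)
       \<and> ((real m - 1) * \<alpha> < \<beta> \<and> \<beta> \<le> (real n - 1) * \<alpha>
            \<and> \<beta> \<le> (real m - 1) * \<alpha> + (real n - 1) * \<alpha>\<^sup>2
            \<longrightarrow> transmission_zero_forcing_number G \<alpha> \<beta> = m + n - 2)
       \<and> (((real n - 1) * \<alpha> < \<beta> \<and> \<beta> \<le> real n * \<alpha>)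
            \<or> ((real m - 1) * \<alpha> + (real n - 1) * \<alpha>\<^sup>2 < \<beta> \<and> \<beta> \<le> real n * \<alpha>)
            \<longrightarrow> transmission_zero_forcing_number G \<alpha> \<beta> = m + n - 1)
       \<and> (real n * \<alpha> < \<beta>
            \<longrightarrow> transmission_zero_forcing_number G \<alpha> \<beta> = m + n)"
proof -
  from assms(7) obtain U V where UV: "verts G = U \<union> V" "U \<inter> V = {}" "card U = m" "card V = n"
    "arcs_ends G = U \<times> V \<union> V \<times> U"
    by (auto simp: complete_bipartite_digraph_def)
  \<comment> \<open>Infinite sets have cardinality 0, so positive cardinalities give
    finiteness.\<close>
  have "finite U" "finite V"
    using UV(3,4) assms(5,6) by (auto intro: card_ge_0_finite)
  then interpret complete_bipartition G U V
    using UV by unfold_locales auto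
  obtain u v where u: "u \<in> U" and v: "v \<in> V"
    using UV(3,4) assms(5,6) by (metis card.empty ex_in_conv not_numeral_le_zero le_trans)
  have card_verts: "card (verts G) = m + n"
    using \<open>finite U\<close> \<open>finite V\<close> UV by (simp add: card_Un_disjoint)
  have card1: "card (verts G - {x}) = m + n - 1" if "x \<in> verts G" for x
    using that card_verts by simp
  have card2: "card (verts G - {x, y}) = m + n - 2" if "x \<in> U" "y \<in> V" for x y
  proof -
    have "x \<noteq> y"
      using that UV(2) by auto
    then show ?thesis
      using that card_verts UV(1) by (simp add: card_Diff_subset)
  qed
  let ?F = "transmission_zero_forcing_set G \<alpha> \<beta>"
  \<comment> \<open>The first two cases of the statement together form the criterion for leaving out
    one vertex of each part.\<close>
  let ?two = "\<beta> \<le> (real m - 1) * \<alpha> \<or>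
    \<beta> \<le> (real n - 1) * \<alpha> \<and> \<beta> \<le> (real m - 1) * \<alpha> + (real n - 1) * \<alpha>\<^sup>2"
  have F1: "?F (verts G - {x}) \<longleftrightarrow> \<beta> \<le> real n * \<alpha>" if "x \<in> U" for x
    using forcing_missing_left_iff[OF that] UV(4) by simp
  have F1': "?F (verts G - {x}) \<longleftrightarrow> \<beta> \<le> real m * \<alpha>" if "x \<in> V" for x
    using forcing_missing_right_iff[OF that] UV(3) by simp
  have F2: "?F (verts G - {x, y}) \<longleftrightarrow> ?two" if "x \<in> U" "y \<in> V" for x y
    using forcing_missing_both_iff[OF that assms(1)] UV(3,4) assms(6) by simp
  \<comment> \<open>A single missing vertex of \<open>V\<close> collects only
    \<open>real m * \<alpha>\<close>, so if leaving it out works, leaving out one of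
    \<open>U\<close> works too.\<close>
  have mono: "real m * \<alpha> \<le> real n * \<alpha>" "(real m - 1) * \<alpha> \<le> (real n - 1) * \<alpha>"
      "(real n - 1) * \<alpha> \<le> real n * \<alpha>"
    using assms(1,6) by (auto intro!: mult_right_mono)
  have "0 \<le> (real n - 1) * \<alpha>\<^sup>2"
    using assms(5,6) by simp
  have card_ge: "m + n - 2 \<le> card C \<and> (\<not> ?two \<longrightarrow> m + n - 1 \<le> card C) \<and>
      (\<not> ?two \<and> \<not> \<beta> \<le> real n * \<alpha> \<longrightarrow> m + n \<le> card C)" if "?F C" for C
    using that assms(3)
  proof (cases rule: forcing_set_cases)
    case 1
    then show ?thesis using card_verts by simp
  next
    case (2 x)
    then show ?thesis using that F1[of x] card1[of x] UV(1) by auto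
  next
    case (3 x)
    then show ?thesis using that F1'[of x] card1[of x] UV(1) mono by auto
  next
    case (4 x y)
    then show ?thesis using that F2[of x y] card2[of x y] by auto
  qed
  have Z2: "transmission_zero_forcing_number G \<alpha> \<beta> = m + n - 2" if ?two
    using that F2[OF u v] card2[OF u v] card_ge by (intro transmission_zero_forcing_number_eqI) auto
  have Z1: "transmission_zero_forcing_number G \<alpha> \<beta> = m + n - 1" if "\<not> ?two" "\<beta> \<le> real n * \<alpha>"
    using that F1[OF u] card1[of u] u UV(1) card_ge
    by (intro transmission_zero_forcing_number_eqI) auto
  have Z0: "transmission_zero_forcing_number G \<alpha> \<beta> = m + n" if "\<not> ?two" "\<not> \<beta> \<le> real n * \<alpha>"
    using that transmission_zero_forcing_set_verts card_verts card_ge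
    by (intro transmission_zero_forcing_number_eqI) auto
  \<comment> \<open>It remains to match the ranges: by \<open>mono\<close> and the nonnegativity of
    the quadratic term, the third and fourth cases each contradict \<open>?two\<close>, and they
    differ in whether \<beta> exceeds \<open>real n * \<alpha>\<close>.\<close>
  show ?thesis
    using Z2 Z1 Z0 mono \<open>0 \<le> (real n - 1) * \<alpha>\<^sup>2\<close> by (smt (verit))
qed

end
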